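(* Let $L \simeq C_{n_1} \oplus \cdots \oplus C_{n_\ell}$, with integers $1 < n_1 \mid \cdots \mid n_\ell$, be a finite Abelian group. For every integer $n \geqslant 1$ such that $\exp(L) \mid n$ and every integer $r \geqslant 1$, the group $L^r_n = L \oplus C_n^r$ satisfies $$\mathsf{D}(L^r_n) \leqslant r(n-1) + 1 + (c_{\ell+r} - r)\left(\frac{n}{P(n)}-1\right) + \frac{n}{P(n)} \sum_{i=1}^{\ell} \left(\gcd(n_i, P(n)) - 1\right).$$
   Context: For an integer $n \geqslant 1$, $C_n$ denotes the cyclic group of order $n$ and $C_n^r$ the direct sum of $r$ copies of $C_n$. For a finite Abelian group $G$, $\exp(G)$ is its exponent. A sequence over $G$ is a finite (unordered, repetitions allowed) sequence of elements of $G$; it is zero-sum if the sum of its elements is $0$. The Davenport constant $\mathsf{D}(G)$ is the smallest integer $t \geqslant 1$ such that every sequence over $G$ of length at least $t$ contains a non-empty zero-sum subsequence. The invariant $\eta(G)$ is the smallest integer $t \geqslant 1$ such that every sequence over $G$ of length at least $t$ contains a non-empty zero-sum subsequence of length at most $\exp(G)$. By a theorem of Alon and Dubiner, for each integer $k \geqslant 1$ there is a constant $c > 0$ such that $\eta(C_n^k) \leqslant c(n-1)+1$ for all integers $n \geqslant 1$; $c_k$ denotes the smallest such constant, i.e. the smallest real number with $\eta(C_n^k) \leqslant c_k(n-1)+1$ for all $n \geqslant 1$. For an integer $n \geqslant 1$, $P(n)$ denotes the greatest prime power dividing $n$, with the convention $P(1)=1$. *)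

theory Defs
  imports Complex_Main "HOL-Algebra.Algebra" "HOL-Library.Multiset" "HOL-Number_Theory.Number_Theory"
begin

text \<open>
  Abelian groups are written multiplicatively, as in \<^theory>\<open>HOL-Algebra.Group\<close>: the ``sum'' of
  a sequence is a product and ``zero-sum'' means that it equals \<^term>\<open>\<one>\<^bsub>G\<^esub>\<close>.
  An unordered sequence with repetitions is a finite multiset, its subsequences are its
  submultisets, and multiplicities enter the sum as group powers.
\<close>

definition sequence_over :: "('a, 'b) monoid_scheme \<Rightarrow> 'a multiset \<Rightarrow> bool" where
  "sequence_over G S \<longleftrightarrow> set_mset S \<subseteq> carrier G"

definition seq_sum :: "('a, 'b) monoid_scheme \<Rightarrow> 'a multiset \<Rightarrow> 'a" where
  "seq_sum G S = finprod G (\<lambda>g. g [^]\<^bsub>G\<^esub> count S g) (set_mset S)"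

definition zero_sum :: "('a, 'b) monoid_scheme \<Rightarrow> 'a multiset \<Rightarrow> bool" where
  "zero_sum G S \<longleftrightarrow> seq_sum G S = \<one>\<^bsub>G\<^esub>"

definition group_exponent :: "('a, 'b) monoid_scheme \<Rightarrow> nat" where
  "group_exponent G = (LEAST e. e \<ge> 1 \<and> (\<forall>g\<in>carrier G. g [^]\<^bsub>G\<^esub> e = \<one>\<^bsub>G\<^esub>))"

definition davenport :: "('a, 'b) monoid_scheme \<Rightarrow> nat" where
  "davenport G = (LEAST t. t \<ge> 1 \<and>
     (\<forall>S. sequence_over G S \<and> size S \<ge> t \<longrightarrow>
        (\<exists>T. T \<subseteq># S \<and> T \<noteq> {#} \<and> zero_sum G T)))"

definition eta :: "('a, 'b) monoid_scheme \<Rightarrow> nat" where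
  "eta G = (LEAST t. t \<ge> 1 \<and>
     (\<forall>S. sequence_over G S \<and> size S \<ge> t \<longrightarrow>
        (\<exists>T. T \<subseteq># S \<and> T \<noteq> {#} \<and> size T \<le> group_exponent G \<and> zero_sum G T)))"

definition cyclic_power :: "nat \<Rightarrow> nat \<Rightarrow> (nat \<Rightarrow> int) monoid" where
  "cyclic_power n r = product_group {1..r} (\<lambda>_. integer_mod_group n)"

definition eta_bound :: "nat \<Rightarrow> real \<Rightarrow> bool" where
  "eta_bound k c \<longleftrightarrow> (\<forall>n\<ge>1. real (eta (cyclic_power n k)) \<le> c * (real n - 1) + 1)"

text \<open>
  The constant \<open>c\<^sub>k\<close> is given as the relation ``\<open>c\<close> is the smallest real number satisfying the
  bound''.  For every \<open>k \<ge> 1\<close> exactly one \<open>c\<close> qualifies: some \<open>c\<close> satisfies the bound by the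
  theorem of Alon and Dubiner, and the set of such \<open>c\<close> is closed and bounded below.
\<close>

definition is_least_eta_const :: "nat \<Rightarrow> real \<Rightarrow> bool" where
  "is_least_eta_const k c \<longleftrightarrow> eta_bound k c \<and> (\<forall>c'. eta_bound k c' \<longrightarrow> c \<le> c')"

definition greatest_primepow :: "nat \<Rightarrow> nat" where
  "greatest_primepow n = (if n = 1 then 1 else Max {q. primepow q \<and> q dvd n})"

end

theory Submission
  imports Defs "HOL-Library.Function_Algebras"
begin

text \<open>
  Write \<open>n = q n'\<close> with \<open>q = P(n)\<close> a power of a prime \<open>p\<close>, so that \<open>q\<close> and \<open>n'\<close> are coprime.
  Regard a sequence over \<open>L\<^sub>n\<^sup>r\<close> modulo \<open>n'\<close> as a sequence over a power of the cyclic group of order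
  \<open>n'\<close>. As long as at least \<open>\<eta>\<close> terms are left, one can split off a subsequence of length at most \<open>n'\<close>
  whose sum vanishes modulo \<open>n'\<close>. The sums of these disjoint subsequences are treated
  modulo \<open>q\<close>: by Olson's theorem \<open>1 + \<Sum>\<^sub>i (gcd(n\<^sub>i, q) - 1) + r (q - 1)\<close> of them
  suffice to find a union of some of them whose sum also vanishes in the \<open>p\<close>-part of the group.

  The upper bound in Olson's theorem follows from finite differences modulo \<open>p\<close>. The indicator
  function of \<open>q\<int>\<close> is \<open>q\<close>-periodic, hence killed modulo \<open>p\<close> by \<open>q\<close> successive differences, as
  \<open>(X - 1)\<^sup>q\<close> is congruent to \<open>X\<^sup>q - 1\<close>. So the product of such indicators over the coordinates is
  killed by \<open>1 + \<Sum>\<^sub>i (q\<^sub>i - 1)\<close> differences. If no non-empty subsequence were zero-sum, the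
  iterated difference at the origin along the terms of the sequence would be \<open>1\<close> up to sign.
\<close>

subsection \<open>Iterated differences modulo an integer\<close>

text \<open>Modulo \<open>p\<close>, the function \<open>f\<close> behaves like a polynomial of degree less than \<open>k\<close>.\<close>
primrec vanishing_differences :: "int \<Rightarrow> nat \<Rightarrow> ('a::comm_monoid_add \<Rightarrow> int) \<Rightarrow> bool" where
  "vanishing_differences p 0 f \<longleftrightarrow> (\<forall>x. p dvd f x)"
| "vanishing_differences p (Suc k) f \<longleftrightarrow> (\<forall>g. vanishing_differences p k (\<lambda>x. f (x + g) - f x))"

lemma vanishing_differences_zero:
  "(\<And>x. p dvd f x) \<Longrightarrow> vanishing_differences p k f"
  by (induction k arbitrary: f) auto

lemma vanishing_differences_Suc:
  "vanishing_differences p k f \<Longrightarrow> vanishing_differences p (Suc k) f"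
proof (induction k arbitrary: f)
  case 0
  then show ?case by (auto intro: dvd_diff)
next
  case (Suc k)
  show ?case
    unfolding vanishing_differences.simps(2)[of p "Suc k"]
    by (intro allI Suc.IH) (use Suc.prems in simp)
qed

lemma vanishing_differences_mono:
  "k \<le> k' \<Longrightarrow> vanishing_differences p k f \<Longrightarrow> vanishing_differences p k' f"
  by (induction rule: dec_induct) (auto simp del: vanishing_differences.simps intro: vanishing_differences_Suc)

lemma vanishing_differences_shift:
  "vanishing_differences p k f \<Longrightarrow> vanishing_differences p k (\<lambda>x. f (x + h))"
proof (induction k arbitrary: f)
  case (Suc k)
  show ?case
    unfolding vanishing_differences.simps
  proof
    fix g
    have "vanishing_differences p k (\<lambda>x. f (x + g) - f x)"
      using Suc.prems by simp
    from Suc.IH[OF this] show "vanishing_differences p k (\<lambda>x. f (x + g + h) - f (x + h))"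
      by (simp add: ac_simps)
  qed
qed simp

lemma vanishing_differences_add:
  "vanishing_differences p k f \<Longrightarrow> vanishing_differences p k f' \<Longrightarrow>
    vanishing_differences p k (\<lambda>x. f x + f' x)"
proof (induction k arbitrary: f f')
  case (Suc k)
  show ?case
    unfolding vanishing_differences.simps
  proof
    fix g
    have "vanishing_differences p k (\<lambda>x. (f (x + g) - f x) + (f' (x + g) - f' x))"
      by (rule Suc.IH) (use Suc.prems in simp_all)
    then show "vanishing_differences p k (\<lambda>x. f (x + g) + f' (x + g) - (f x + f' x))"
      by (simp add: algebra_simps)
  qed
qed auto

text \<open>Discrete Leibniz rule: a difference of the product splits into two products of smaller
  total order. In the \<open>Suc\<close> form \<open>a\<close> and \<open>b\<close> act as degree
  bounds, which add up.\<close>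

lemma vanishing_differences_mult:
  "vanishing_differences p (Suc a) f \<Longrightarrow> vanishing_differences p (Suc b) f' \<Longrightarrow>
    vanishing_differences p (Suc (a + b)) (\<lambda>x. f x * f' x)"
proof (induction "a + b" arbitrary: a b f f' rule: less_induct)
  case less
  show ?case
    unfolding vanishing_differences.simps(2)[of p "a + b"]
  proof
    fix g
    let ?d = "\<lambda>x. f (x + g) - f x" and ?d' = "\<lambda>x. f' (x + g) - f' x"
    have d: "vanishing_differences p a ?d" and d': "vanishing_differences p b ?d'"
      using less.prems by simp_all
    have s: "vanishing_differences p (Suc b) (\<lambda>x. f' (x + g))"
      by (rule vanishing_differences_shift[OF less.prems(2)])
    have "vanishing_differences p (a + b) (\<lambda>x. ?d x * f' (x + g))"
    \<comment> \<open>For \<open>a = 0\<close> the induction hypothesis does not apply, but then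
      \<open>p\<close> divides every value of \<open>?d\<close>.\<close>
    proof (cases a)
      case 0
      then show ?thesis using d by (intro vanishing_differences_zero) auto
    next
      case (Suc a')
      then have "vanishing_differences p (Suc (a' + b)) (\<lambda>x. ?d x * f' (x + g))"
        using d by (intro less.hyps[OF _ _ s]) simp_all
      then show ?thesis using Suc by simp
    qed
    moreover have "vanishing_differences p (a + b) (\<lambda>x. f x * ?d' x)"
    proof (cases b)
      case 0
      then show ?thesis using d' by (intro vanishing_differences_zero) auto
    next
      case (Suc b')
      then have "vanishing_differences p (Suc (a + b')) (\<lambda>x. f x * ?d' x)"
        using d' by (intro less.hyps[OF _ less.prems(1)]) simp_all
      then show ?thesis using Suc by simp
    qed
    ultimately have "vanishing_differences p (a + b) (\<lambda>x. ?d x * f' (x + g) + f x * ?d' x)"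
      by (rule vanishing_differences_add)
    then show "vanishing_differences p (a + b) (\<lambda>x. f (x + g) * f' (x + g) - f x * f' x)"
      by (simp add: algebra_simps)
  qed
qed

lemma vanishing_differences_prod:
  assumes "finite I" "\<And>i. i \<in> I \<Longrightarrow> vanishing_differences p (Suc (a i)) (f i)"
  shows "vanishing_differences p (Suc (\<Sum>i\<in>I. a i)) (\<lambda>x. \<Prod>i\<in>I. f i x)"
  using assms
proof (induction I rule: finite_induct)
  case empty
  then show ?case by simp
next
  case (insert i I)
  then show ?case
    using vanishing_differences_mult[of p "a i" "f i" "sum a I" "\<lambda>x. \<Prod>i\<in>I. f i x"]
    by (simp del: vanishing_differences.simps)
qed

lemma vanishing_differences_component:
  fixes f :: "int \<Rightarrow> int"
  shows "vanishing_differences p k f \<Longrightarrow> vanishing_differences p k (\<lambda>x :: 'b \<Rightarrow> int. f (x i))"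
proof (induction k arbitrary: f)
  case (Suc k)
  show ?case
    unfolding vanishing_differences.simps
  proof
    fix g :: "'b \<Rightarrow> int"
    show "vanishing_differences p k (\<lambda>x. f ((x + g) i) - f (x i))"
      using Suc.IH[of "\<lambda>y. f (y + g i) - f y"] Suc.prems by simp
  qed
qed simp

text \<open>Differencing along all \<open>v j\<close> gives an alternating sum of \<open>f\<close>
  over the subset sums, where modulo \<open>p\<close> only the empty subset can contribute. The
  induction replaces \<open>f\<close> by its difference along one \<open>v j\<close>, for which the
  condition on nonempty subsets persists.\<close>

lemma vanishing_differences_subset_sum:
  assumes "finite J" "vanishing_differences p (card J) f"
    and "\<And>T. T \<subseteq> J \<Longrightarrow> T \<noteq> {} \<Longrightarrow> p dvd f (x + (\<Sum>j\<in>T. v j))"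
  shows "p dvd f x"
  using assms
proof (induction J arbitrary: f rule: finite_induct)
  case empty
  then show ?case by simp
next
  case (insert j J)
  have "p dvd f (x + v j) - f x"
  proof (rule insert.IH[of "\<lambda>x. f (x + v j) - f x"])
    show "vanishing_differences p (card J) (\<lambda>x. f (x + v j) - f x)"
      using insert.prems(1) insert.hyps by simp
  next
    fix T assume T: "T \<subseteq> J" "T \<noteq> {}"
    then have "j \<notin> T" "finite T"
      using insert.hyps finite_subset by blast+
    then have "p dvd f (x + (\<Sum>j\<in>T. v j) + v j)"
      using insert.prems(2)[of "insert j T"] T by (auto simp: ac_simps)
    moreover have "p dvd f (x + (\<Sum>j\<in>T. v j))"
      using insert.prems(2)[of T] T by auto
    ultimately show "p dvd f (x + (\<Sum>j\<in>T. v j) + v j) - f (x + (\<Sum>j\<in>T. v j))"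
      by (rule dvd_diff)
  qed
  moreover have "p dvd f (x + v j)"
    using insert.prems(2)[of "{j}"] by simp
  ultimately show ?case
    by (metis diff_diff_eq2 add_diff_cancel_left' dvd_diff)
qed

subsection \<open>Olson's bound for abelian \<open>p\<close>-groups\<close>

abbreviation forward_difference :: "(int \<Rightarrow> int) \<Rightarrow> int \<Rightarrow> int" where
  "forward_difference f \<equiv> \<lambda>s. f (s + 1) - f s"

text \<open>Pascal's rule after an index shift; the added top term vanishes because
  \<open>n choose Suc n\<close> is \<open>0\<close>.\<close>

lemma sum_choose_Suc:
  fixes a :: "nat \<Rightarrow> int"
  shows "(\<Sum>k\<le>Suc n. int (Suc n choose k) * a k) = (\<Sum>k\<le>n. int (n choose k) * (a k + a (Suc k)))"
proof -
  have "(\<Sum>k\<le>n. int (n choose k) * a k) = (\<Sum>k\<le>Suc n. int (n choose k) * a k)"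
    by simp
  also have "\<dots> = a 0 + (\<Sum>k\<le>n. int (n choose Suc k) * a (Suc k))"
    by (subst sum.atMost_Suc_shift) simp
  finally show ?thesis
    by (subst sum.atMost_Suc_shift) (simp add: sum.distrib algebra_simps)
qed

text \<open>The unit shift is the identity plus \<open>forward_difference\<close>; its
  \<open>n\<close>-th power is expanded binomially.\<close>

lemma newton_forward_difference:
  "f (s + int n) = (\<Sum>k\<le>n. int (n choose k) * (forward_difference ^^ k) f s)"
proof (induction n arbitrary: f)
  case (Suc n)
  have "f (s + int (Suc n)) = f (s + int n) + forward_difference f (s + int n)"
    by (simp add: algebra_simps)
  also have "\<dots> = (\<Sum>k\<le>n. int (n choose k) *
      ((forward_difference ^^ k) f s + (forward_difference ^^ Suc k) f s))"
    using Suc.IH[of f] Suc.IH[of "forward_difference f"]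
    by (simp only: funpow_Suc_right o_apply distrib_left sum.distrib)
  also have "\<dots> = (\<Sum>k\<le>Suc n. int (Suc n choose k) * (forward_difference ^^ k) f s)"
    by (rule sum_choose_Suc[symmetric])
  finally show ?case .
qed simp

text \<open>Otherwise \<open>p ^ a\<close> is coprime to the binomial coefficient, and the
  absorption identity makes it divide \<open>k\<close>, which is too small.\<close>

lemma prime_dvd_prime_power_choose:
  assumes "Factorial_Ring.prime p" "0 < k" "k < p ^ a"
  shows "p dvd (p ^ a choose k)"
proof (rule ccontr)
  assume "\<not> p dvd (p ^ a choose k)"
  then have "coprime (p ^ a) (p ^ a choose k)"
    using assms(1) by (simp add: prime_imp_coprime)
  moreover have "k * (p ^ a choose k) = p ^ a * (p ^ a - 1 choose (k - 1))"
    using assms times_binomial_minus1_eq by blast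
  ultimately have "p ^ a dvd k"
    by (metis coprime_dvd_mult_left_iff dvd_triv_left)
  with assms show False
    by (auto dest: dvd_imp_le)
qed

text \<open>Modulo \<open>p\<close> only the two extreme terms of the Newton expansion over
  \<open>p ^ a\<close> steps survive.\<close>

lemma forward_difference_prime_power:
  assumes "Factorial_Ring.prime p"
  shows "int p dvd f (s + int (p ^ a)) - f s - (forward_difference ^^ (p ^ a)) f s"
proof -
  let ?t = "\<lambda>k. int (p ^ a choose k) * (forward_difference ^^ k) f s"
  have pos: "p ^ a > 0"
    using assms prime_gt_0_nat by simp
  then have "{..p ^ a} = insert 0 (insert (p ^ a) {0<..<p ^ a})"
    by auto
  then have "f (s + int (p ^ a)) = ?t 0 + (?t (p ^ a) + (\<Sum>k\<in>{0<..<p ^ a}. ?t k))"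
    using pos by (subst newton_forward_difference) simp
  moreover have "int p dvd (\<Sum>k\<in>{0<..<p ^ a}. ?t k)"
    by (intro dvd_sum dvd_mult2) (use prime_dvd_prime_power_choose[OF assms] in auto)
  ultimately show ?thesis by simp
qed

text \<open>Unit steps control all directions: a difference with arbitrary step \<open>g\<close>
  telescopes into unit steps of either sign, and it commutes with
  \<open>forward_difference\<close>.\<close>

lemma vanishing_differences_forward:
  assumes "\<And>s. p dvd (forward_difference ^^ k) f s"
  shows "vanishing_differences p k f"
  using assms
proof (induction k arbitrary: f)
  case (Suc k)
  let ?h = "(forward_difference ^^ k) f"
  have step: "p dvd ?h (s + 1) - ?h s" for s
    using Suc.prems[of s] by simp
  have const: "p dvd ?h (s + g) - ?h s" for s g
  proof (induction g rule: int_induct[where k = 0])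
    case (step1 i)
    then show ?case using dvd_add[OF step1(2) step[of "s + i"]] by (simp add: algebra_simps)
  next
    case (step2 i)
    then show ?case using dvd_diff[OF step2(2) step[of "s + i - 1"]] by (simp add: algebra_simps)
  qed simp
  have comm: "(forward_difference ^^ k) (\<lambda>x. f (x + g) - f x) s
      = (forward_difference ^^ k) f (s + g) - (forward_difference ^^ k) f s" for f g s
  proof (induction k arbitrary: s)
    case (Suc k)
    show ?case
      by (simp add: Suc.IH ac_simps)
  qed simp
  show ?case
    unfolding vanishing_differences.simps
  proof
    fix g
    show "vanishing_differences p k (\<lambda>x. f (x + g) - f x)"
      by (rule Suc.IH) (simp only: comm const)
  qed
qed simp

lemma vanishing_differences_periodic:
  assumes "Factorial_Ring.prime p" "\<And>s. f (s + int (p ^ a)) = f s"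
  shows "vanishing_differences (int p) (p ^ a) f"
proof (rule vanishing_differences_forward)
  fix s
  show "int p dvd (forward_difference ^^ (p ^ a)) f s"
    using forward_difference_prime_power[OF assms(1), of f s a] assms(2) by simp
qed

lemma sum_fun_component: "(\<Sum>j\<in>T. v j) i = (\<Sum>j\<in>T. v j i)"
  by (induction T rule: infinite_finite_induct) auto

lemma olson_upper_bound:
  fixes v :: "'j \<Rightarrow> 'i \<Rightarrow> int"
  assumes "Factorial_Ring.prime p" "finite I" "finite J" "card J > (\<Sum>i\<in>I. p ^ a i - 1)"
  shows "\<exists>T\<subseteq>J. T \<noteq> {} \<and> (\<forall>i\<in>I. int (p ^ a i) dvd (\<Sum>j\<in>T. v j i))"
proof (rule ccontr)
  assume none: "\<not> ?thesis"
  define f :: "('i \<Rightarrow> int) \<Rightarrow> int"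
    where "f x = (\<Prod>i\<in>I. of_bool (int (p ^ a i) dvd x i))" for x
  have "vanishing_differences (int p) (Suc (\<Sum>i\<in>I. p ^ a i - 1)) f"
    unfolding f_def
  proof (rule vanishing_differences_prod[OF \<open>finite I\<close>])
    fix i
    have "vanishing_differences (int p) (p ^ a i) (\<lambda>x :: 'i \<Rightarrow> int. of_bool (int (p ^ a i) dvd x i))"
      by (intro vanishing_differences_component vanishing_differences_periodic[OF assms(1)]) simp
    moreover have "Suc (p ^ a i - 1) = p ^ a i"
      using prime_gt_0_nat[OF assms(1)] by simp
    ultimately show "vanishing_differences (int p) (Suc (p ^ a i - 1))
        (\<lambda>x :: 'i \<Rightarrow> int. of_bool (int (p ^ a i) dvd x i))"
      by (simp only:)
  qed
  then have "vanishing_differences (int p) (card J) f"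
    by (rule vanishing_differences_mono[rotated]) (use assms(4) in simp)
  moreover have "int p dvd f (0 + (\<Sum>j\<in>T. v j))" if T: "T \<subseteq> J" "T \<noteq> {}" for T
  proof -
    obtain i where "i \<in> I" "\<not> int (p ^ a i) dvd (\<Sum>j\<in>T. v j i)"
      using none T by blast
    then have "f (0 + (\<Sum>j\<in>T. v j)) = 0"
      unfolding f_def by (intro prod_zero[OF \<open>finite I\<close>] bexI[of _ i]) (simp_all add: sum_fun_component)
    then show ?thesis
      by simp
  qed
  ultimately have "int p dvd f 0"
    by (rule vanishing_differences_subset_sum[OF \<open>finite J\<close>, of "int p" f 0 v])
  \<comment> \<open>Every \<open>p ^ a i\<close> divides \<open>0\<close>, so
    \<open>f 0 = 1\<close>, which \<open>p\<close> cannot divide.\<close>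
  then show False
    using \<open>Factorial_Ring.prime p\<close> by (simp add: f_def)
qed

subsection \<open>Disjoint short subsequences\<close>

text \<open>Greedy choice: before the last of \<open>N\<close> choices at least \<open>e\<close>
  indices are left. The summand \<open>m\<close> stands on the left of the size condition to avoid
  the truncated difference \<open>N - 1\<close>.\<close>

lemma exists_disjoint_subsets:
  assumes short: "\<And>J'. J' \<subseteq> J \<Longrightarrow> card J' \<ge> e \<Longrightarrow> \<exists>T\<subseteq>J'. T \<noteq> {} \<and> card T \<le> m \<and> P T"
    and "finite J" "card J + m \<ge> m * N + e"
  shows "\<exists>F. finite F \<and> card F = N \<and> pairwise disjnt F \<and> (\<forall>T\<in>F. T \<subseteq> J \<and> T \<noteq> {} \<and> P T)"
  using assms
proof (induction N arbitrary: J)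
  case 0
  show ?case by (rule exI[of _ "{}"]) simp
next
  case (Suc N)
  have "card J \<ge> e"
    using Suc.prems(3) by simp
  with Suc.prems(1) obtain T where T: "T \<subseteq> J" "T \<noteq> {}" "card T \<le> m" "P T"
    by blast
  have "card (J - T) + m \<ge> card J"
    using T Suc.prems(2) by (simp add: card_Diff_subset finite_subset)
  then have "card (J - T) + m \<ge> m * N + e"
    using Suc.prems(3) by simp
  moreover have "\<exists>T\<subseteq>J'. T \<noteq> {} \<and> card T \<le> m \<and> P T" if "J' \<subseteq> J - T" "card J' \<ge> e" for J'
    using Suc.prems(1)[of J'] that by blast
  ultimately obtain F where F: "finite F" "card F = N" "pairwise disjnt F"
      "\<forall>T'\<in>F. T' \<subseteq> J - T \<and> T' \<noteq> {} \<and> P T'"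
    using Suc.IH[of "J - T"] Suc.prems(2) by blast
  have "T \<notin> F"
    using F(4) T(2) by blast
  moreover have "pairwise disjnt (insert T F)"
    using F(3,4) by (auto simp: pairwise_insert disjnt_def)
  ultimately show ?case
    using F T by (intro exI[of _ "insert T F"]) auto
qed

text \<open>Expanding the product by distributivity gives a gcd of \<open>gcd d x * d\<close> and
  \<open>gcd d x * y\<close>, both multiples of \<open>d\<close>.\<close>

lemma dvd_gcd_mult_gcd:
  fixes d x y :: nat
  assumes "d dvd x * y"
  shows "d dvd gcd d x * gcd d y"
proof -
  have "d dvd y * gcd d x"
    unfolding gcd_mult_distrib_nat using assms by (simp add: mult.commute)
  then have "d dvd gcd (gcd d x * d) (gcd d x * y)"
    by (simp add: mult.commute)
  then show ?thesis
    by (simp only: gcd_mult_distrib_nat)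
qed

text \<open>Disjoint blocks with sums divisible by \<open>m\<close> become the terms of a new
  sequence, to which Olson's bound is applied for the \<open>p\<close>-part. Coprimality lets the
  two divisibilities combine.\<close>

lemma zero_sum_subset_coprime:
  fixes v :: "'j \<Rightarrow> 'i \<Rightarrow> int"
  assumes p: "Factorial_Ring.prime p" and "finite I" "finite J"
    and cop: "coprime (p ^ a) m" and dvd: "\<And>i. i \<in> I \<Longrightarrow> d i dvd p ^ a * m"
    and short: "\<And>J'. J' \<subseteq> J \<Longrightarrow> card J' \<ge> e \<Longrightarrow>
      \<exists>T\<subseteq>J'. T \<noteq> {} \<and> card T \<le> m \<and> (\<forall>i\<in>I. int m dvd (\<Sum>j\<in>T. v j i))"
    and card: "card J \<ge> m * (\<Sum>i\<in>I. gcd (d i) (p ^ a) - 1) + e"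
  shows "\<exists>T\<subseteq>J. T \<noteq> {} \<and> (\<forall>i\<in>I. int (d i) dvd (\<Sum>j\<in>T. v j i))"
proof -
  \<comment> \<open>\<open>N\<close> is one above the sum in Olson's bound, so
    \<open>m * N + e\<close> exceeds the assumed lower bound for \<open>card J\<close> by exactly
    \<open>m\<close>.\<close>
  define N where "N = Suc (\<Sum>i\<in>I. gcd (d i) (p ^ a) - 1)"
  have "card J + m \<ge> m * N + e"
    using card by (simp add: N_def)
  from exists_disjoint_subsets[OF short \<open>finite J\<close> this]
  obtain F where F: "finite F" "card F = N" "pairwise disjnt F"
      "\<forall>T\<in>F. T \<subseteq> J \<and> T \<noteq> {} \<and> (\<forall>i\<in>I. int m dvd (\<Sum>j\<in>T. v j i))"
    by blast
  have "\<forall>i. \<exists>b. gcd (d i) (p ^ a) = p ^ b"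
    using divides_primepow_nat[OF p] by (metis gcd_dvd2)
  then obtain b where b: "\<And>i. gcd (d i) (p ^ a) = p ^ b i"
    by metis
  have "card F > (\<Sum>i\<in>I. p ^ b i - 1)"
    by (simp add: F(2) N_def b)
  \<comment> \<open>The index set is now the family of blocks, and the vector attached to a block is
    its sum.\<close>
  from olson_upper_bound[OF p \<open>finite I\<close> \<open>finite F\<close> this, of "\<lambda>T i. \<Sum>j\<in>T. v j i"]
  obtain A where A: "A \<subseteq> F" "A \<noteq> {}"
      "\<forall>i\<in>I. int (p ^ b i) dvd (\<Sum>T\<in>A. \<Sum>j\<in>T. v j i)"
    by blast
  have fin: "finite T" if "T \<in> A" for T
    using that A(1) F(4) \<open>finite J\<close> by (meson finite_subset subsetD)
  have disj: "\<forall>T\<in>A. \<forall>T'\<in>A. T \<noteq> T' \<longrightarrow> T \<inter> T' = {}"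
    using A(1) F(3) unfolding pairwise_def disjnt_def by blast
  have sum: "(\<Sum>j\<in>\<Union>A. v j i) = (\<Sum>T\<in>A. \<Sum>j\<in>T. v j i)" for i
    using fin disj by (simp add: sum.Union_disjoint)
  have "int (d i) dvd (\<Sum>j\<in>\<Union>A. v j i)" if "i \<in> I" for i
  proof -
    have "int (d i) dvd int (gcd (d i) (p ^ a)) * int (gcd (d i) m)"
      unfolding of_nat_mult[symmetric] int_dvd_int_iff by (rule dvd_gcd_mult_gcd[OF dvd[OF that]])
    moreover have "int (gcd (d i) (p ^ a)) dvd (\<Sum>j\<in>\<Union>A. v j i)"
      unfolding sum b using A(3) that by blast
    moreover have "int (gcd (d i) m) dvd (\<Sum>j\<in>\<Union>A. v j i)"
    proof -
      have "int m dvd (\<Sum>j\<in>\<Union>A. v j i)"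
        unfolding sum
      proof (rule dvd_sum)
        fix T assume "T \<in> A"
        then show "int m dvd (\<Sum>j\<in>T. v j i)"
          using A(1) F(4) \<open>i \<in> I\<close> by (simp add: subset_iff)
      qed
      then show ?thesis
        by (meson dvd_trans gcd_dvd2 int_dvd_int_iff)
    qed
    moreover have "coprime (int (gcd (d i) (p ^ a))) (int (gcd (d i) m))"
      using cop by (meson coprime_divisors coprime_int_iff gcd_dvd2)
    ultimately show ?thesis
      by (meson divides_mult dvd_trans)
  qed
  moreover have "\<Union>A \<subseteq> J" "\<Union>A \<noteq> {}"
    using A(1,2) F(4) by blast+
  ultimately show ?thesis
    by blast
qed

subsection \<open>Zero-sum sequences in coordinates\<close>

lemma sum_mset_image_count:
  fixes f :: "'x \<Rightarrow> 'y::comm_semiring_1"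
  shows "(\<Sum>x\<in>#S. f x) = (\<Sum>x\<in>set_mset S. of_nat (count S x) * f x)"
proof (induction S)
  case (add x S)
  have "(\<Sum>y\<in>set_mset (add_mset x S). of_nat (count (add_mset x S) y) * f y)
      = (\<Sum>y\<in>insert x (set_mset S). (if y = x then f x else 0) + of_nat (count S y) * f y)"
    by (intro sum.cong) (auto simp: algebra_simps)
  also have "\<dots> = f x + (\<Sum>y\<in>insert x (set_mset S). of_nat (count S y) * f y)"
    by (simp add: sum.distrib sum.delta)
  also have "(\<Sum>y\<in>insert x (set_mset S). of_nat (count S y) * f y)
      = (\<Sum>y\<in>set_mset S. of_nat (count S y) * f y)"
    by (intro sum.mono_neutral_right) (auto simp: not_in_iff)
  finally show ?case
    by (simp add: add)
qed simp

lemma seq_sum_closed: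
  assumes "comm_group G" "sequence_over G S"
  shows "seq_sum G S \<in> carrier G"
proof -
  interpret comm_group G by fact
  show ?thesis
    using assms(2) unfolding seq_sum_def sequence_over_def by (intro finprod_closed) auto
qed

text \<open>Transfers zero-sum conditions to integers: products become sums modulo \<open>d\<close>,
  and powers become multiples.\<close>

lemma hom_seq_sum:
  assumes "comm_group G" "\<chi> \<in> hom G (integer_mod_group d)" "sequence_over G S"
  shows "\<chi> (seq_sum G S) = (\<Sum>x\<in>#S. \<chi> x) mod int d"
proof -
  interpret comm_group G by fact
  interpret h: group_hom G "integer_mod_group d" \<chi>
    by (intro group_hom.intro group_hom_axioms.intro) (simp_all add: assms)
  have fin: "\<chi> (finprod G f A) = (\<Sum>x\<in>A. \<chi> (f x)) mod int d" if "finite A" "f \<in> A \<rightarrow> carrier G" for f A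
    using that
    by (induction A rule: finite_induct) (simp_all add: h.hom_one h.hom_mult Pi_iff mod_simps)
  have "\<chi> (seq_sum G S) = (\<Sum>x\<in>set_mset S. \<chi> (x [^]\<^bsub>G\<^esub> count S x)) mod int d"
    using assms(3) unfolding seq_sum_def sequence_over_def by (intro fin) auto
  also have "\<dots> = (\<Sum>x\<in>set_mset S. (int (count S x) * \<chi> x) mod int d) mod int d"
    using assms(3) by (intro arg_cong[where f = "\<lambda>s. s mod int d"] sum.cong)
      (auto simp: sequence_over_def h.hom_nat_pow)
  finally show ?thesis
    by (simp add: mod_sum_eq sum_mset_image_count)
qed

lemma zero_sum_hom:
  assumes "comm_group G" "\<chi> \<in> hom G (integer_mod_group d)" "sequence_over G S" "zero_sum G S"
  shows "int d dvd (\<Sum>x\<in>#S. \<chi> x)"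
  using hom_seq_sum[OF assms(1-3)] assms(4) hom_one[OF assms(2)] comm_group.axioms(2)[OF assms(1)]
  by (simp add: zero_sum_def dvd_eq_mod_eq_0)

text \<open>The order of the group is an admissible exponent by Lagrange, so the
  \<open>LEAST\<close> is attained.\<close>

lemma group_exponent_pow:
  assumes "comm_group G" "finite (carrier G)"
  shows "group_exponent G \<ge> 1" "g \<in> carrier G \<Longrightarrow> g [^]\<^bsub>G\<^esub> group_exponent G = \<one>\<^bsub>G\<^esub>"
proof -
  interpret comm_group G by fact
  have "card (carrier G) \<ge> 1"
    using assms(2) one_closed card_gt_0_iff by (metis One_nat_def Suc_leI empty_iff)
  then have "card (carrier G) \<ge> 1 \<and> (\<forall>g\<in>carrier G. g [^]\<^bsub>G\<^esub> card (carrier G) = \<one>\<^bsub>G\<^esub>)"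
    using power_order_eq_one[OF assms(2)] by simp
  then have *: "group_exponent G \<ge> 1 \<and> (\<forall>g\<in>carrier G. g [^]\<^bsub>G\<^esub> group_exponent G = \<one>\<^bsub>G\<^esub>)"
    unfolding group_exponent_def by (rule LeastI)
  show "group_exponent G \<ge> 1"
    using * by simp
  show "g [^]\<^bsub>G\<^esub> group_exponent G = \<one>\<^bsub>G\<^esub>" if "g \<in> carrier G"
    using * that by simp
qed

text \<open>The minimum defining \<open>eta\<close> is attained: among more than
  \<open>card (carrier G) * group_exponent G\<close> terms some element occurs at least
  \<open>group_exponent G\<close> times, and that many copies of it are zero-sum.\<close>

lemma eta_zero_sum:
  assumes "comm_group G" "finite (carrier G)" "sequence_over G S" "size S \<ge> eta G"
  shows "\<exists>T. T \<subseteq># S \<and> T \<noteq> {#} \<and> size T \<le> group_exponent G \<and> zero_sum G T"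
proof -
  interpret comm_group G by fact
  let ?e = "group_exponent G"
  let ?Q = "\<lambda>t. t \<ge> 1 \<and> (\<forall>S. sequence_over G S \<and> size S \<ge> t \<longrightarrow>
        (\<exists>T. T \<subseteq># S \<and> T \<noteq> {#} \<and> size T \<le> ?e \<and> zero_sum G T))"
  have "?Q (Suc (card (carrier G) * ?e))"
  proof (intro conjI allI impI)
    fix S assume S: "sequence_over G S \<and> Suc (card (carrier G) * ?e) \<le> size S"
    have "\<exists>g\<in>set_mset S. count S g \<ge> ?e"
    proof (rule ccontr)
      assume "\<not> ?thesis"
      then have "size S \<le> (\<Sum>g\<in>set_mset S. ?e)"
        unfolding size_multiset_overloaded_eq by (intro sum_mono) auto
      also have "\<dots> \<le> card (carrier G) * ?e"
        using S assms(2) by (simp add: sequence_over_def card_mono)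
      finally show False using S by simp
    qed
    then obtain g where g: "g \<in># S" "count S g \<ge> ?e" by blast
    then have "g \<in> carrier G"
      using S by (auto simp: sequence_over_def)
    then have "zero_sum G (replicate_mset ?e g)"
      using group_exponent_pow[OF assms(1,2)] by (simp add: zero_sum_def seq_sum_def)
    then show "\<exists>T. T \<subseteq># S \<and> T \<noteq> {#} \<and> size T \<le> ?e \<and> zero_sum G T"
      using g group_exponent_pow(1)[OF assms(1,2)]
      by (intro exI[of _ "replicate_mset ?e g"]) (auto simp: count_le_replicate_mset_subset_eq)
  qed simp
  then have "?Q (eta G)"
    unfolding eta_def by (rule LeastI)
  then show ?thesis
    using assms(3,4) by blast
qed

text \<open>Passes from submultisets to index sets, where equal terms at different positions stay
  distinct.\<close>

lemma subseteq_image_mset_set: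
  assumes "finite J" "T \<subseteq># image_mset y (mset_set J)"
  shows "\<exists>A\<subseteq>J. T = image_mset y (mset_set A)"
  using assms
proof (induction J arbitrary: T rule: finite_induct)
  case (insert j J)
  have T: "T - {#y j#} \<subseteq># image_mset y (mset_set J)"
    using insert.prems insert.hyps by (simp add: subset_eq_diff_conv)
  show ?case
  proof (cases "y j \<in># T")
    case True
    from insert.IH[OF T] obtain A where A: "A \<subseteq> J" "T - {#y j#} = image_mset y (mset_set A)"
      by blast
    then have "finite A" "j \<notin> A"
      using insert.hyps finite_subset by blast+
    then have "T = image_mset y (mset_set (insert j A))"
      using A(2) True by (metis image_mset_add_mset insert_DiffM mset_set.insert)
    then show ?thesis
      using A(1) by (metis insert_mono)
  next
    case False
    then show ?thesis
      using insert.IH[of T] T by (metis diff_single_trivial subset_insertI2)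
  qed
qed simp

section \<open>Powers of cyclic groups and families of integer vectors\<close>

lemma comm_group_cyclic_power: "comm_group (cyclic_power n k)"
proof (rule group.group_comm_groupI)
  show "group (cyclic_power n k)"
    by (simp add: cyclic_power_def)
qed (simp add: cyclic_power_def add.commute)

lemma hom_product_group_component:
  "i \<in> I \<Longrightarrow> (\<lambda>x. x i) \<in> hom (product_group I G) (G i)"
  by (rule homI) auto

lemma product_group_pow:
  assumes "\<And>i. i \<in> I \<Longrightarrow> group (G i)" "x \<in> carrier (product_group I G)" "i \<in> I"
  shows "(x [^]\<^bsub>product_group I G\<^esub> (k::nat)) i = x i [^]\<^bsub>G i\<^esub> k"
  using hom_nat_pow[OF hom_product_group_component[OF assms(3)] assms(2)] assms(1,3) by simp

lemma finite_carrier_cyclic_power: "n \<ge> 1 \<Longrightarrow> finite (carrier (cyclic_power n k))"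
  by (simp add: cyclic_power_def carrier_integer_mod_group finite_PiE)

lemma group_exponent_cyclic_power_le:
  assumes "n \<ge> 1"
  shows "group_exponent (cyclic_power n k) \<le> n"
  unfolding group_exponent_def
proof (rule Least_le, intro conjI ballI)
  fix g assume g: "g \<in> carrier (cyclic_power n k)"
  have "group (cyclic_power n k)"
    by (rule comm_group.axioms) (rule comm_group_cyclic_power)
  then have c: "g [^]\<^bsub>cyclic_power n k\<^esub> n \<in> carrier (cyclic_power n k)"
    using g by (simp add: group.is_monoid monoid.nat_pow_closed)
  show "g [^]\<^bsub>cyclic_power n k\<^esub> n = \<one>\<^bsub>cyclic_power n k\<^esub>"
  proof
    fix i
    show "(g [^]\<^bsub>cyclic_power n k\<^esub> n) i = \<one>\<^bsub>cyclic_power n k\<^esub> i"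
    proof (cases "i \<in> {1..k}")
      case True
      then show ?thesis
        using g product_group_pow[of "{1..k}" "\<lambda>_. integer_mod_group n" g i n]
        by (simp add: cyclic_power_def)
    next
      \<comment> \<open>Outside the index range both functions are \<open>undefined\<close> by
        extensionality.\<close>
      case False
      then show ?thesis
        using c PiE_arb[of _ "{1..k}" _ i] by (auto simp: cyclic_power_def)
    qed
  qed
qed (use assms in simp)

text \<open>Coordinates reduced modulo \<open>n\<close> give a sequence over the cyclic power, whose
  exponent is at most \<open>n\<close>; this turns the length bound in \<open>eta\<close> into
  \<open>card T \<le> n\<close>.\<close>

lemma eta_cyclic_power_subset:
  fixes v :: "'j \<Rightarrow> nat \<Rightarrow> int"
  assumes "n \<ge> 1" "finite J" "card J \<ge> eta (cyclic_power n k)"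
  shows "\<exists>T\<subseteq>J. T \<noteq> {} \<and> card T \<le> n \<and> (\<forall>i\<in>{1..k}. int n dvd (\<Sum>j\<in>T. v j i))"
proof -
  let ?C = "cyclic_power n k"
  define y where "y j = (\<lambda>i\<in>{1..k}. v j i mod int n)" for j
  have y: "y j \<in> carrier ?C" for j
    using \<open>n \<ge> 1\<close> by (auto simp: y_def cyclic_power_def carrier_integer_mod_group)
  obtain S where S: "S \<subseteq># image_mset y (mset_set J)" "S \<noteq> {#}"
      "size S \<le> group_exponent ?C" "zero_sum ?C S"
    using eta_zero_sum[OF comm_group_cyclic_power finite_carrier_cyclic_power[OF \<open>n \<ge> 1\<close>],
        where S = "image_mset y (mset_set J)"] y assms(2,3)
    by (auto simp: sequence_over_def)
  from subseteq_image_mset_set[OF \<open>finite J\<close> S(1)]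
  obtain T where T: "T \<subseteq> J" "S = image_mset y (mset_set T)"
    by blast
  then have "T \<noteq> {}" "finite T"
    using S(2) \<open>finite J\<close> finite_subset by auto
  moreover have "card T \<le> n"
    using S(3) T(2) group_exponent_cyclic_power_le[OF \<open>n \<ge> 1\<close>, of k] by simp
  moreover have "int n dvd (\<Sum>j\<in>T. v j i)" if i: "i \<in> {1..k}" for i
  proof -
    have "(\<lambda>x. x i) \<in> hom ?C (integer_mod_group n)"
      unfolding cyclic_power_def using hom_product_group_component[OF i] .
    moreover have "sequence_over ?C S"
      using y T(2) by (auto simp: sequence_over_def)
    ultimately have "int n dvd (\<Sum>x\<in>#S. x i)"
      using zero_sum_hom[OF comm_group_cyclic_power _ _ S(4)] by blast
    also have "(\<Sum>x\<in>#S. x i) = (\<Sum>j\<in>T. v j i mod int n)"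
      using i by (simp add: T(2) y_def sum_unfold_sum_mset image_mset.compositionality o_def)
    finally show ?thesis
      by (simp add: dvd_eq_mod_eq_0 mod_sum_eq)
  qed
  ultimately show ?thesis
    using T(1) by blast
qed

text \<open>The homomorphisms \<open>\<chi> i\<close> jointly detect the identity, so a subsequence
  is zero-sum once its integer coordinate sums are divisible by the \<open>d i\<close>.\<close>

lemma davenport_le:
  fixes \<chi> :: "'i \<Rightarrow> 'a \<Rightarrow> int" and G :: "('a, 'b) monoid_scheme"
  assumes G: "comm_group G"
    and hom: "\<And>i. i \<in> I \<Longrightarrow> \<chi> i \<in> hom G (integer_mod_group (d i))"
    and inj: "\<And>x. x \<in> carrier G \<Longrightarrow> \<forall>i\<in>I. \<chi> i x = 0 \<Longrightarrow> x = \<one>\<^bsub>G\<^esub>"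
    and "t \<ge> 1"
    and subset: "\<And>(J :: nat set) v. finite J \<Longrightarrow> card J \<ge> t \<Longrightarrow>
      \<exists>T\<subseteq>J. T \<noteq> {} \<and> (\<forall>i\<in>I. int (d i) dvd (\<Sum>j\<in>T. v j i))"
  shows "davenport G \<le> t"
  unfolding davenport_def
proof (rule Least_le, intro conjI allI impI)
  fix S assume S: "sequence_over G S \<and> t \<le> size S"
  obtain xs where xs: "mset xs = S"
    using ex_mset by blast
  \<comment> \<open>List positions serve as indices, so repeated terms are kept apart.\<close>
  have xs': "S = image_mset (\<lambda>j. xs ! j) (mset_set {0..<length xs})"
    by (simp flip: xs mset_upt mset_map add: map_nth)
  have "card {0..<length xs} \<ge> t"
    using S xs by auto
  from subset[OF _ this, of "\<lambda>j i. \<chi> i (xs ! j)"]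
  obtain A where A: "A \<subseteq> {0..<length xs}" "A \<noteq> {}"
      "\<forall>i\<in>I. int (d i) dvd (\<Sum>j\<in>A. \<chi> i (xs ! j))"
    by blast
  then have "finite A"
    using finite_subset by blast
  let ?T = "image_mset (\<lambda>j. xs ! j) (mset_set A)"
  have sub: "?T \<subseteq># S"
    unfolding xs' using A(1) by (intro image_mset_subseteq_mono) (simp add: subset_imp_msubset_mset_set)
  then have T: "sequence_over G ?T"
    using S set_mset_mono[OF sub] by (auto simp: sequence_over_def)
  have "zero_sum G ?T"
    unfolding zero_sum_def
  proof (rule inj)
    show "seq_sum G ?T \<in> carrier G"
      by (rule seq_sum_closed[OF G T])
    show "\<forall>i\<in>I. \<chi> i (seq_sum G ?T) = 0"
      using A(3) hom_seq_sum[OF G hom T]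
      by (simp add: sum_unfold_sum_mset image_mset.compositionality o_def)
  qed
  then show "\<exists>T. T \<subseteq># S \<and> T \<noteq> {#} \<and> zero_sum G T"
    using sub A(2) \<open>finite A\<close> by (intro exI[of _ ?T]) (simp add: mset_set_empty_iff)
qed fact

section \<open>Divisibility by the exponent and the greatest prime power\<close>

lemma group_exponent_dvd_component:
  fixes L :: "('a, 'b) monoid_scheme"
  assumes L: "comm_group L" "finite (carrier L)"
    and iso: "L \<cong> product_group I (\<lambda>i. integer_mod_group (m i))"
    and "i \<in> I" "m i > 1" "group_exponent L dvd n"
  shows "m i dvd n"
proof -
  let ?P = "product_group I (\<lambda>i. integer_mod_group (m i))"
  have P: "group ?P" and gL: "group L"
    using L(1) by (auto intro: comm_group.axioms)
  obtain h where h: "h \<in> iso L ?P"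
    using iso by (auto simp: is_iso_def)
  \<comment> \<open>The unit vector at coordinate \<open>i\<close> has order \<open>m i\<close>, and
    its preimage in \<open>L\<close> is killed by \<open>n\<close>.\<close>
  define e where "e = (\<lambda>j\<in>I. if j = i then 1 else 0 :: int)"
  have e: "e \<in> carrier ?P"
    using \<open>m i > 1\<close> by (auto simp: e_def)
  have "e \<in> h ` carrier L"
    using h e by (simp add: iso_def bij_betw_def)
  then obtain x where x: "x \<in> carrier L" "h x = e"
    by blast
  obtain k where "n = group_exponent L * k"
    using assms(6) by blast
  then have "x [^]\<^bsub>L\<^esub> n = \<one>\<^bsub>L\<^esub>"
    using group_exponent_pow(2)[OF L x(1)] x(1) gL
    by (metis group.is_monoid monoid.nat_pow_one monoid.nat_pow_pow)
  then have "e [^]\<^bsub>?P\<^esub> n = \<one>\<^bsub>?P\<^esub>"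
    using x h hom_nat_pow[of h L ?P x n] hom_one[of h L ?P] gL P by (simp add: iso_def)
  then have "1 [^]\<^bsub>integer_mod_group (m i)\<^esub> n = (0::int)"
    using product_group_pow[OF _ e \<open>i \<in> I\<close>, of n] \<open>i \<in> I\<close> by (simp add: e_def)
  then show ?thesis
    by (simp add: dvd_eq_mod_eq_0 flip: of_nat_mod)
qed

lemma greatest_primepow_decomp:
  assumes "n \<ge> 1"
  obtains p a m where "Factorial_Ring.prime p" "greatest_primepow n = p ^ a" "n = p ^ a * m"
    "coprime (p ^ a) m"
proof (cases "n = 1")
  case True
  \<comment> \<open>The convention \<open>P(1) = 1\<close> is represented as \<open>2 ^ 0\<close>
    with cofactor \<open>1\<close>.\<close>
  then show ?thesis
    using that[of 2 0 1] by (simp add: greatest_primepow_def two_is_prime_nat)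
next
  case False
  let ?Q = "{q. primepow q \<and> q dvd n}"
  obtain p0 where "Factorial_Ring.prime p0" "p0 dvd n"
    using prime_factor_nat[OF False] by blast
  then have "?Q \<noteq> {}"
    using primepow_prime by blast
  moreover have fin: "finite ?Q"
    using assms by (intro finite_subset[OF _ finite_divisors_nat[of n]]) auto
  ultimately have "greatest_primepow n \<in> ?Q"
    using Max_in[of ?Q] False by (simp add: greatest_primepow_def)
  then obtain p a where p: "Factorial_Ring.prime p" "a > 0" "greatest_primepow n = p ^ a" "p ^ a dvd n"
    by (auto simp: primepow_def)
  then obtain m where m: "n = p ^ a * m"
    by blast
  \<comment> \<open>Another factor \<open>p\<close> would make \<open>p ^ Suc a\<close> a larger
    prime power dividing \<open>n\<close>.\<close>
  have "\<not> p dvd m"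
  proof
    assume "p dvd m"
    then have "p ^ Suc a dvd n"
      using m by (auto simp: mult.assoc mult.commute[of p])
    moreover have "primepow (p ^ Suc a)"
      using p(1) by (auto simp: primepow_def simp del: power_Suc)
    ultimately have "p ^ Suc a \<le> p ^ a"
      using Max_ge[OF fin, of "p ^ Suc a"] False p(3) by (simp add: greatest_primepow_def)
    then show False
      using prime_gt_1_nat[OF p(1)] by (simp del: power_Suc)
  qed
  then have "coprime (p ^ a) m"
    using p(1) by (simp add: prime_imp_coprime)
  then show ?thesis
    by (rule that[OF p(1,3) m])
qed

section \<open>Assembly of the bound for the direct sum\<close>

theorem theorem4:
  fixes L :: "('a, 'b) monoid_scheme"
    and m :: "nat \<Rightarrow> nat" and l n r :: nat and c :: real
  assumes "comm_group L" and "finite (carrier L)"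
    and "L \<cong> product_group {1..l} (\<lambda>i. integer_mod_group (m i))"
    and "\<And>i. i \<in> {1..l} \<Longrightarrow> 1 < m i"
    and "\<And>i. 1 \<le> i \<Longrightarrow> i < l \<Longrightarrow> m i dvd m (i + 1)"
    and "n \<ge> 1" and "group_exponent L dvd n" and "r \<ge> 1"
    and "is_least_eta_const (l + r) c"
  shows "real (davenport (L \<times>\<times> cyclic_power n r)) \<le>
      real r * (real n - 1) + 1
      + (c - real r) * (real n / real (greatest_primepow n) - 1)
      + (real n / real (greatest_primepow n))
        * (\<Sum>i = 1..l. (real (gcd (m i) (greatest_primepow n)) - 1))"
proof -
  obtain p a n' where p: "Factorial_Ring.prime p" "greatest_primepow n = p ^ a" "n = p ^ a * n'"
      "coprime (p ^ a) n'"
    by (rule greatest_primepow_decomp[OF \<open>n \<ge> 1\<close>])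
  have pos: "p ^ a > 0" "n' \<ge> 1"
    using p(1,3) \<open>n \<ge> 1\<close> prime_gt_0_nat by (auto intro: Suc_leI gr0I)
  define e where "e = eta (cyclic_power n' (l + r))"
  define d where "d i = (if i \<le> l then m i else n)" for i
  let ?G = "L \<times>\<times> cyclic_power n r" and ?I = "{1..l + r}"
  let ?t = "n' * (\<Sum>i\<in>?I. gcd (d i) (p ^ a) - 1) + e"
  obtain h where h: "h \<in> iso L (product_group {1..l} (\<lambda>i. integer_mod_group (m i)))"
    using assms(3) by (auto simp: is_iso_def)
  have gL: "group L"
    using assms(1) by (rule comm_group.axioms)
  have gC: "group (cyclic_power n r)"
    using comm_group_cyclic_power by (rule comm_group.axioms)
  \<comment> \<open>The first \<open>l\<close> coordinates read off \<open>L\<close> through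
    \<open>h\<close>, the remaining \<open>r\<close> the cyclic power, with indices shifted by
    \<open>l\<close>.\<close>
  define \<chi> where "\<chi> i x = (if i \<le> l then h (fst x) i else snd x (i - l))" for i x
  have "davenport ?G \<le> ?t"
  proof (rule davenport_le)
    show "comm_group ?G"
      using assms(1) comm_group_cyclic_power[of n r]
      by (intro group.group_comm_groupI[OF DirProd_group[OF gL gC]])
        (auto simp: comm_groupE(4))
  next
    fix i assume i: "i \<in> ?I"
    show "\<chi> i \<in> hom ?G (integer_mod_group (d i))"
    proof (cases "i \<le> l")
      case True
      have "(\<lambda>y. y i) \<circ> (h \<circ> fst) \<in> hom ?G (integer_mod_group (m i))"
      proof (rule hom_compose)
        show "h \<circ> fst \<in> hom ?G (product_group {1..l} (\<lambda>i. integer_mod_group (m i)))"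
          using h by (simp add: hom_of_fst[OF gC] iso_def)
        show "(\<lambda>y. y i) \<in> hom (product_group {1..l} (\<lambda>i. integer_mod_group (m i))) (integer_mod_group (m i))"
          using True i hom_product_group_component[of i "{1..l}"] by auto
      qed
      then show ?thesis
        using True by (simp add: \<chi>_def[abs_def] d_def o_def)
    next
      case False
      have "(\<lambda>y. y (i - l)) \<in> hom (cyclic_power n r) (integer_mod_group n)"
        using i False unfolding cyclic_power_def by (intro hom_product_group_component) auto
      then have "(\<lambda>y. y (i - l)) \<circ> snd \<in> hom ?G (integer_mod_group n)"
        by (simp only: hom_of_snd[OF gL])
      then show ?thesis
        using False by (simp add: \<chi>_def[abs_def] d_def o_def)
    qed
  next
    fix x assume x: "x \<in> carrier ?G" "\<forall>i\<in>?I. \<chi> i x = 0"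
    obtain y z where yz: "x = (y, z)" "y \<in> carrier L" "z \<in> carrier (cyclic_power n r)"
      using x(1) by auto
    let ?P = "product_group {1..l} (\<lambda>i. integer_mod_group (m i))"
    have hom: "h \<in> hom L ?P" and inj: "inj_on h (carrier L)"
      using h by (auto simp: iso_def bij_betw_def)
    have "h y i = \<one>\<^bsub>?P\<^esub> i" for i
    proof (cases "i \<in> {1..l}")
      case True
      then show ?thesis
        using x(2)[rule_format, of i] yz(1) by (simp add: \<chi>_def)
    next
      case False
      then show ?thesis
        using PiE_arb[of "h y" "{1..l}" _ i] hom_in_carrier[OF hom yz(2)] by auto
    qed
    then have "h y = \<one>\<^bsub>?P\<^esub>" ..
    also have "\<one>\<^bsub>?P\<^esub> = h \<one>\<^bsub>L\<^esub>"
      using hom_one[OF hom gL] by simp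
    finally have "y = \<one>\<^bsub>L\<^esub>"
      using inj yz(2) gL by (simp add: inj_on_eq_iff group.is_monoid)
    moreover have "z i = \<one>\<^bsub>cyclic_power n r\<^esub> i" for i
    proof (cases "i \<in> {1..r}")
      case True
      then show ?thesis
        using x(2)[rule_format, of "l + i"] yz(1) by (simp add: \<chi>_def cyclic_power_def)
    next
      case False
      then show ?thesis
        using PiE_arb[of z "{1..r}" _ i] yz(3) by (auto simp: cyclic_power_def)
    qed
    then have "z = \<one>\<^bsub>cyclic_power n r\<^esub>" ..
    ultimately show "x = \<one>\<^bsub>?G\<^esub>"
      by (simp add: yz(1))
  next
    \<comment> \<open>If \<open>eta\<close> were \<open>0\<close>, the empty sequence would contain
      a nonempty subsequence.\<close>
    have "e \<noteq> 0"
      using eta_zero_sum[OF comm_group_cyclic_power finite_carrier_cyclic_power[OF pos(2)],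
          where S = "{#}"]
      by (auto simp: sequence_over_def e_def)
    then show "?t \<ge> 1" by simp
  next
    fix J :: "nat set" and v :: "nat \<Rightarrow> nat \<Rightarrow> int"
    assume J: "finite J" "card J \<ge> ?t"
    show "\<exists>T\<subseteq>J. T \<noteq> {} \<and> (\<forall>i\<in>?I. int (d i) dvd (\<Sum>j\<in>T. v j i))"
    proof (rule zero_sum_subset_coprime[OF p(1) _ J(1) p(4)])
      fix i assume "i \<in> ?I"
      then show "d i dvd p ^ a * n'"
        using group_exponent_dvd_component[OF assms(1-3) _ assms(4) assms(7)] p(3)
        by (auto simp: d_def)
    next
      fix J' assume "J' \<subseteq> J" "e \<le> card J'"
      then show "\<exists>T\<subseteq>J'. T \<noteq> {} \<and> card T \<le> n' \<and> (\<forall>i\<in>?I. int n' dvd (\<Sum>j\<in>T. v j i))"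
        using J(1) pos(2) finite_subset unfolding e_def by (intro eta_cyclic_power_subset) auto
    qed (use J in simp_all)
  qed
  then have "real (davenport ?G) \<le> real ?t"
    by (simp only: of_nat_le_iff)
  \<comment> \<open>Each gcd is positive because \<open>p ^ a > 0\<close>, so the natural-number
    subtractions are exact.\<close>
  also have "real ?t = real n' * (\<Sum>i\<in>?I. real (gcd (d i) (p ^ a)) - 1) + real e"
    using pos by (simp add: of_nat_diff Suc_leI)
  also have "(\<Sum>i\<in>?I. real (gcd (d i) (p ^ a)) - 1)
      = (\<Sum>i=1..l. real (gcd (m i) (p ^ a)) - 1) + (\<Sum>i=l+1..l+r. real (p ^ a) - 1)"
  proof -
    \<comment> \<open>For \<open>i > l\<close> the modulus \<open>d i\<close> is \<open>n\<close>, a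
      multiple of \<open>p ^ a\<close>, so its gcd with \<open>p ^ a\<close> is
      \<open>p ^ a\<close>.\<close>
    have "?I = {1..l} \<union> {l+1..l+r}" by auto
    then show ?thesis
      using p(3) by (simp add: sum.union_disjoint d_def)
  qed
  also have "real e \<le> c * (real n' - 1) + 1"
    using assms(9) pos(2) by (simp add: is_least_eta_const_def eta_bound_def e_def)
  \<comment> \<open>Since \<open>n' * p ^ a = n\<close>, the terms
    \<open>n' * r * (p ^ a - 1) + c * (n' - 1)\<close> regroup as
    \<open>r * (n - 1) + (c - r) * (n' - 1)\<close>.\<close>
  finally show ?thesis
    unfolding p(2) using pos p(3) by (simp add: algebra_simps)
qed

end
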